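(* Let $(V,b)$ be an orthogonal bilinear space over $\mathbb{F}_2$ with $\dim V$ even, and let $A,P\in \mathrm{Iso}(V,b)$. Then $m(PAP^{-1})=P\circ m(A)\circ P^{-1}$.
   Context: A bilinear space over $\mathbb{F}_2$ is a finite-dimensional $\mathbb{F}_2$-vector space $V$ with a nondegenerate symmetric bilinear form $b$; it is orthogonal if it is isomorphic to $\mathbb{F}_2^n$ with the standard dot product for some $n\ge1$. $\mathrm{Iso}(V,b)$ is the group of linear automorphisms $f$ of $V$ with $b(f(x),f(y))=b(x,y)$ for all $x,y$. The distinguished vector $\Omega\in V$ is the unique vector with $b(\Omega,v)=b(v,v)$ for all $v\in V$. For $\dim V$ even and $L\in\mathrm{Iso}(V,b)$, the mirror $mL\in\mathrm{Iso}(V,b)$ is defined by $mL(v)=L(v)+b(v,\Omega)\Omega$. *)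

theory Defs
  imports "HOL-Library.Z2" "Jordan_Normal_Form.Matrix"
begin

text \<open>The field with two elements is the type \<^typ>\<open>bit\<close>; the space \<open>V\<close> is the whole
  type \<open>'v\<close> with scalar multiplication \<open>scale\<close>.\<close>

locale bilinear_space_F2 = vector_space scale
  for scale :: "bit \<Rightarrow> 'v::ab_group_add \<Rightarrow> 'v" +
  fixes b :: "'v \<Rightarrow> 'v \<Rightarrow> bit"
  assumes finite_dim: "\<exists>B. finite B \<and> span B = UNIV"
    and linear_left: "Vector_Spaces.linear scale (*) (\<lambda>x. b x y)"
    and linear_right: "Vector_Spaces.linear scale (*) (\<lambda>y. b x y)"
    and symmetric: "b x y = b y x"
    and nondegenerate: "(\<And>y. b x y = 0) \<Longrightarrow> x = 0"

text \<open>The model \<open>F\<^sub>2\<^sup>n\<close> is \<open>carrier_vec n\<close> with \<open>scalar_prod\<close>. Since \<^typ>\<open>bit vec\<close>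
  contains vectors of all lengths, it is not itself a vector space, and linearity of the
  isomorphism is spelled out.\<close>

locale orthogonal_bilinear_space_F2 = bilinear_space_F2 scale b
  for scale :: "bit \<Rightarrow> 'v::ab_group_add \<Rightarrow> 'v" and b :: "'v \<Rightarrow> 'v \<Rightarrow> bit" +
  assumes orthogonal: "\<exists>n\<ge>1. \<exists>\<phi> :: 'v \<Rightarrow> bit vec.
    bij_betw \<phi> UNIV (carrier_vec n) \<and>
    (\<forall>x y. \<phi> (x + y) = \<phi> x + \<phi> y) \<and>
    (\<forall>c x. \<phi> (scale c x) = c \<cdot>\<^sub>v \<phi> x) \<and>
    (\<forall>x y. b x y = scalar_prod (\<phi> x) (\<phi> y))"

definition Iso :: "(bit \<Rightarrow> 'v::ab_group_add \<Rightarrow> 'v) \<Rightarrow> ('v \<Rightarrow> 'v \<Rightarrow> bit) \<Rightarrow> ('v \<Rightarrow> 'v) set"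
  where "Iso scale b =
    {f. Vector_Spaces.linear scale scale f \<and> bij f \<and> (\<forall>x y. b (f x) (f y) = b x y)}"

definition distinguished_vector :: "('v \<Rightarrow> 'v \<Rightarrow> bit) \<Rightarrow> 'v"
  where "distinguished_vector b = (THE w. \<forall>v. b w v = b v v)"

text \<open>A total function; it is meaningful only for \<open>L \<in> Iso scale b\<close> on a space of even
  dimension.\<close>

definition mirror ::
    "(bit \<Rightarrow> 'v::ab_group_add \<Rightarrow> 'v) \<Rightarrow> ('v \<Rightarrow> 'v \<Rightarrow> bit) \<Rightarrow> ('v \<Rightarrow> 'v) \<Rightarrow> 'v \<Rightarrow> 'v"
  where "mirror scale b L =
    (\<lambda>v. L v + scale (b v (distinguished_vector b)) (distinguished_vector b))"

end

theory Submission imports Defs begin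

text \<open>\<open>\<Omega>\<close> is characterised by \<open>b\<close> alone, so every isometry fixes it, and therefore the
  correction term \<open>v \<mapsto> b v \<Omega> \<cdot> \<Omega>\<close> commutes with every isometry \<open>P\<close>. Existence of \<open>\<Omega>\<close> is where
  orthogonality enters: it is the all-ones vector, because \<open>c * c = c\<close> in \<open>F\<^sub>2\<close>.\<close>

context bilinear_space_F2
begin

text \<open>The difference of two such vectors pairs to zero with everything, so nondegeneracy kills
  it.\<close>

lemma distinguished_unique:
  assumes "\<And>v. b w v = b v v" "\<And>v. b w' v = b v v"
  shows "w = w'"
proof -
  have "b (w - w') y = 0" for y
  proof -
    interpret left: Vector_Spaces.linear scale "(*)" "\<lambda>x. b x y" by (rule linear_left)
    show ?thesis using assms by (simp add: left.diff)
  qed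
  then have "w - w' = 0" by (rule nondegenerate)
  then show ?thesis by simp
qed

lemma distinguished_vector_eqI:
  assumes "\<And>v. b w v = b v v"
  shows "distinguished_vector b = w"
  unfolding distinguished_vector_def
  using assms distinguished_unique by (intro the_equality) auto

end

context orthogonal_bilinear_space_F2
begin

text \<open>Exhibiting a witness makes the definite description behind \<Omega> meaningful.\<close>

lemma distinguished_vector_left: "b (distinguished_vector b) v = b v v"
proof -
  obtain n and \<phi> :: "'v \<Rightarrow> bit vec" where bij: "bij_betw \<phi> UNIV (carrier_vec n)"
    and dot: "\<And>x y. b x y = scalar_prod (\<phi> x) (\<phi> y)"
    using orthogonal by blast
  have "vec n (\<lambda>_. 1 :: bit) \<in> \<phi> ` UNIV"
    using bij by (simp add: bij_betw_def)
  then obtain w where w: "\<phi> w = vec n (\<lambda>_. 1)" by auto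
  have "b w x = b x x" for x
  proof -
    \<comment> \<open>\<open>scalar_prod\<close> sums over the indices of its second argument; the
      entries of \<open>\<phi> w\<close> are known to be 1 only below \<open>n\<close>.\<close>
    have "dim_vec (\<phi> x) = n"
      using bij_betwE[OF bij] by auto
    moreover have "c * c = c" for c :: bit
      by (cases c) auto
    ultimately show ?thesis
      unfolding dot w scalar_prod_def by (intro sum.cong) auto
  qed
  with distinguished_vector_eqI[of w] show ?thesis by simp
qed

text \<open>The image of \<Omega> satisfies the same characterisation: by surjectivity it suffices
  to test it on vectors \<open>P u\<close>, where the isometry property reduces it to that of
  \<Omega>.\<close>

lemma Iso_distinguished_vector:
  assumes "P \<in> Iso scale b"
  shows "P (distinguished_vector b) = distinguished_vector b"
proof (rule distinguished_unique)
  fix v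
  have "surj P" and iso: "\<And>x y. b (P x) (P y) = b x y"
    using assms by (auto simp: Iso_def bij_is_surj)
  obtain u where "v = P u" using \<open>surj P\<close> by (rule surjE)
  then show "b (P (distinguished_vector b)) v = b v v"
    by (simp add: iso distinguished_vector_left)
qed (rule distinguished_vector_left)

lemma mirror_conjugate:
  assumes "P \<in> Iso scale b"
  shows "mirror scale b (P \<circ> A \<circ> Hilbert_Choice.inv P)
    = P \<circ> mirror scale b A \<circ> Hilbert_Choice.inv P"
proof
  fix v
  let ?w = "distinguished_vector b"
  have lin: "Vector_Spaces.linear scale scale P" and bij: "bij P"
    and iso: "\<And>x y. b (P x) (P y) = b x y"
    using assms by (auto simp: Iso_def)
  interpret P: Vector_Spaces.linear scale scale P by (rule lin)
  \<comment> \<open>Applying \<open>P\<close> to both arguments cancels the inverse in the first and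
    fixes \<Omega> in the second, so the two correction terms have equal coefficients.\<close>
  have "b (Hilbert_Choice.inv P v) ?w = b v ?w"
    using iso[of "Hilbert_Choice.inv P v" ?w] bij
    by (simp add: Iso_distinguished_vector[OF assms] bij_is_surj surj_f_inv_f)
  then show "mirror scale b (P \<circ> A \<circ> Hilbert_Choice.inv P) v
      = (P \<circ> mirror scale b A \<circ> Hilbert_Choice.inv P) v"
    by (simp add: mirror_def P.add P.scale Iso_distinguished_vector[OF assms])
qed

end

theorem proposition2p8:
  fixes scale :: "bit \<Rightarrow> 'v::ab_group_add \<Rightarrow> 'v"
    and b :: "'v \<Rightarrow> 'v \<Rightarrow> bit"
    and A P :: "'v \<Rightarrow> 'v"
  assumes "orthogonal_bilinear_space_F2 scale b"
    and "even (vector_space.dim scale (UNIV :: 'v set))"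
    and "A \<in> Iso scale b" and "P \<in> Iso scale b"
  shows "mirror scale b (P \<circ> A \<circ> Hilbert_Choice.inv P) = P \<circ> mirror scale b A \<circ> Hilbert_Choice.inv P"
  using assms(1,4) by (rule orthogonal_bilinear_space_F2.mirror_conjugate)

end
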